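(* Let $x_1\geq x_2\geq\cdots\geq x_7$ be real numbers such that $x_1+x_6\geq x_2+x_5\geq x_3+x_4$. Let $a_1,\dots,a_7\in\mathbb{R}$ satisfy $a_1\geq |a_2|\geq a_5\geq |a_6|-a_7$, $a_3\geq |a_4|$, and $a_5,a_7\geq 0$, and let $g:\mathbb{R}\to\mathbb{R}$ be a function in class $\mathcal{G}_2$. Then $$\sum_{i=1}^7 a_i\prod_{\substack{1\leq j\leq 7\\ j\neq i}} g(x_i-x_j)\geq 0.$$
   Context: A function $g:\mathbb{R}\to\mathbb{R}$ is in class $\mathcal{G}$ if $g$ is either even or odd, $g(0)\geq 0$, and $g$ is monotonically nondecreasing on $[0,\infty)$. A function $g:\mathbb{R}\to\mathbb{R}$ is in class $\mathcal{G}_2$ if $g$ is in class $\mathcal{G}$ and for all $x\geq y\geq 0$ and $z\geq 0$, $$g(x)g(y+z)\geq g(y)g(x+z)\quad\text{and}\quad g(x)+g(y+z)\leq g(y)+g(x+z).$$ *)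

theory Defs
  imports Complex_Main
begin

definition even_fun :: "(real \<Rightarrow> real) \<Rightarrow> bool" where
  "even_fun g \<longleftrightarrow> (\<forall>x. g (- x) = g x)"

definition odd_fun :: "(real \<Rightarrow> real) \<Rightarrow> bool" where
  "odd_fun g \<longleftrightarrow> (\<forall>x. g (- x) = - g x)"

definition class_G :: "(real \<Rightarrow> real) set" where
  "class_G = {g. (even_fun g \<or> odd_fun g) \<and> g 0 \<ge> 0 \<and> mono_on {0..} g}"

definition class_G2 :: "(real \<Rightarrow> real) set" where
  "class_G2 = {g \<in> class_G. \<forall>x y z. x \<ge> y \<and> y \<ge> 0 \<and> z \<ge> 0 \<longrightarrow>
     g x * g (y + z) \<ge> g y * g (x + z) \<and> g x + g (y + z) \<le> g y + g (x + z)}"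

end

(* Write Q_i for the product of the g |x_i - x_j| over all j different from i. By parity of g the sum is
   at least a_1 Q_1 - |a_2| Q_2 + a_3 Q_3 - |a_4| Q_4 + a_5 Q_5 - |a_6| Q_6 + a_7 Q_7, which splits as
   a sum of nonnegative multiples of Q_1 - Q_2, Q_3 - Q_4, Q_7 - Q_6 and Q_1 - Q_2 + Q_5 - Q_6.
   Monotonicity gives Q_1 >= Q_2 and Q_7 >= Q_6, the multiplicative condition (log-concavity) gives
   Q_3 >= Q_4, and the additive condition (convexity) controls Q_1 - Q_2 + Q_5 - Q_6. *)
theory Submission
  imports Defs
begin

lemma class_G2_mono:
  assumes "g \<in> class_G2" "0 \<le> s" "s \<le> t"
  shows "g s \<le> g t"
  using assms by (auto simp: class_G2_def class_G_def intro: mono_onD)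

lemma class_G2_nonneg:
  assumes "g \<in> class_G2" "0 \<le> t"
  shows "0 \<le> g t"
  using class_G2_mono[OF assms(1) order_refl assms(2)] assms(1)
  by (simp add: class_G2_def class_G_def)

lemma class_G2_log_concave:
  assumes "g \<in> class_G2" "0 \<le> y" "y \<le> x" "0 \<le> z"
  shows "g y * g (x + z) \<le> g x * g (y + z)"
  using assms by (auto simp: class_G2_def)

lemma class_G2_convex:
  assumes "g \<in> class_G2" "0 \<le> y" "y \<le> x" "0 \<le> z"
  shows "g x + g (y + z) \<le> g y + g (x + z)"
  using assms by (auto simp: class_G2_def)

text \<open>Convexity slides the interval from \<open>s\<close> to \<open>t\<close> with its length
  kept; monotonicity then absorbs any extra length.\<close>

lemma class_G2_increment:
  assumes "g \<in> class_G2" "0 \<le> s" "s \<le> s'" "s \<le> t" "s' - s \<le> t' - t"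
  shows "g s' - g s \<le> g t' - g t"
proof -
  have "g t + g (s + (s' - s)) \<le> g s + g (t + (s' - s))"
    using assms by (intro class_G2_convex[OF assms(1)]) auto
  moreover have "g (t + (s' - s)) \<le> g t'"
    using assms by (intro class_G2_mono[OF assms(1)]) auto
  ultimately show ?thesis by simp
qed

text \<open>Packs the even and odd cases into one sign, so that all factors can be reoriented in a
  single computation.\<close>

lemma class_G2_parity:
  assumes "g \<in> class_G2"
  obtains s where "s = 1 \<or> s = - 1" "\<And>t. g (- t) = s * g t"
  using assms
  by (auto simp: class_G2_def class_G_def even_fun_def odd_fun_def
      intro: that[of 1] that[of "- 1"])

text \<open>After the shared factor \<open>g (x3 - x4)\<close>, the factors at \<open>x5\<close> and
  \<open>x2\<close> are paired, and those at \<open>x6\<close> and \<open>x1\<close>. In each pair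
  the two arguments have the same sum on both sides, so log-concavity compares them; the hypotheses
  \<open>s\<close> say which pair is more balanced. The factor at \<open>x7\<close> needs only
  monotonicity.\<close>

lemma products_third_ge_fourth:
  fixes x1 x2 x3 x4 x5 x6 x7 :: real
  assumes g: "g \<in> class_G2"
    and o: "x1 \<ge> x2" "x2 \<ge> x3" "x3 \<ge> x4" "x4 \<ge> x5" "x5 \<ge> x6" "x6 \<ge> x7"
    and s: "x1 + x6 \<ge> x3 + x4" "x2 + x5 \<ge> x3 + x4"
  shows "g (x1 - x4) * g (x2 - x4) * g (x3 - x4) * g (x4 - x5) * g (x4 - x6) * g (x4 - x7)
    \<le> g (x1 - x3) * g (x2 - x3) * g (x3 - x4) * g (x3 - x5) * g (x3 - x6) * g (x3 - x7)"
proof -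
  note nn = class_G2_nonneg[OF g]
  have p: "g (x4 - x5) * g (x2 - x4) \<le> g (x2 - x3) * g (x3 - x5)"
    using class_G2_log_concave[OF g, of "x4 - x5" "x2 - x3" "x3 - x4"] o s by simp
  have q: "g (x4 - x6) * g (x1 - x4) \<le> g (x1 - x3) * g (x3 - x6)"
    using class_G2_log_concave[OF g, of "x4 - x6" "x1 - x3" "x3 - x4"] o s by simp
  have r: "g (x4 - x7) \<le> g (x3 - x7)"
    using o by (intro class_G2_mono[OF g]) auto
  have "(g (x4 - x5) * g (x2 - x4)) * (g (x4 - x6) * g (x1 - x4)) * g (x4 - x7) * g (x3 - x4)
    \<le> (g (x2 - x3) * g (x3 - x5)) * (g (x1 - x3) * g (x3 - x6)) * g (x3 - x7) * g (x3 - x4)"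
    using o by (intro mult_right_mono mult_mono[OF mult_mono[OF p q] r] mult_nonneg_nonneg nn) auto
  then show ?thesis by (simp add: mult_ac)
qed

text \<open>Each side is a difference with a common gap factor, \<open>g (x5 - x6)\<close> on the
  left and the larger \<open>g (x1 - x2)\<close> on the right. Setting aside this gap and the
  factors at \<open>x7\<close> leaves a comparison of fourfold products.\<close>

lemma products_six_le_one_two_five:
  fixes x1 x2 x3 x4 x5 x6 x7 :: real
  assumes g: "g \<in> class_G2"
    and o: "x1 \<ge> x2" "x2 \<ge> x3" "x3 \<ge> x4" "x4 \<ge> x5" "x5 \<ge> x6" "x6 \<ge> x7"
    and s: "x1 + x6 \<ge> x2 + x5" "x2 + x5 \<ge> x3 + x4"
  shows "g (x1 - x6) * g (x2 - x6) * g (x3 - x6) * g (x4 - x6) * g (x5 - x6) * g (x6 - x7)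
      - g (x1 - x5) * g (x2 - x5) * g (x3 - x5) * g (x4 - x5) * g (x5 - x6) * g (x5 - x7)
    \<le> g (x1 - x2) * g (x1 - x3) * g (x1 - x4) * g (x1 - x5) * g (x1 - x6) * g (x1 - x7)
      - g (x1 - x2) * g (x2 - x3) * g (x2 - x4) * g (x2 - x5) * g (x2 - x6) * g (x2 - x7)"
proof -
  note nn = class_G2_nonneg[OF g] and mono = class_G2_mono[OF g] and incr = class_G2_increment[OF g]
  define R1 where "R1 = g (x1 - x3) * g (x1 - x4) * g (x1 - x5) * g (x1 - x6)
    - g (x2 - x3) * g (x2 - x4) * g (x2 - x5) * g (x2 - x6)"
  define R2 where "R2 = g (x1 - x6) * g (x2 - x6) * g (x3 - x6) * g (x4 - x6)
    - g (x1 - x5) * g (x2 - x5) * g (x3 - x5) * g (x4 - x5)"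
  define E where "E = g (x1 - x3) * g (x1 - x4) - g (x3 - x6) * g (x4 - x6)"
  define F where "F = g (x2 - x3) * g (x2 - x4) - g (x3 - x5) * g (x4 - x5)"

  \<comment> \<open>Both sides are differences of twofold products, telescoped so that every
    increment and every cofactor can be compared separately. The increments on the right start later
    and have length \<open>x1 - x2\<close>, at least \<open>x5 - x6\<close>.\<close>
  have "(g (x4 - x6) - g (x4 - x5)) * g (x3 - x6) + g (x4 - x5) * (g (x3 - x6) - g (x3 - x5))
      \<le> (g (x1 - x3) - g (x2 - x3)) * g (x1 - x4) + g (x2 - x3) * (g (x1 - x4) - g (x2 - x4))"
    using o s by (intro add_mono mult_mono incr nn mono) (auto simp: mono)
  then have FE: "F \<le> E"
    by (simp add: E_def F_def algebra_simps)
  have F0: "0 \<le> F"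
    unfolding F_def using o s mult_mono[OF mono[of "x4 - x5" "x2 - x3"] mono[of "x3 - x5" "x2 - x4"]]
    by (simp add: nn mult_ac)

  \<comment> \<open>\<open>R2 \<le> R1\<close> is regrouped by its terms in
    \<open>g (x2 - x5)\<close> and in \<open>g (x1 - x6)\<close>. Since
    \<open>x2 - x6 \<le> x1 - x5\<close>, trading \<open>g (x1 - x5)\<close> for
    \<open>g (x2 - x6)\<close> brings the brackets down to \<open>F\<close> and
    \<open>E\<close>.\<close>
  have "g (x2 - x5) * (g (x2 - x3) * g (x2 - x4) * g (x2 - x6) - g (x1 - x5) * g (x3 - x5) * g (x4 - x5))
      \<le> g (x2 - x5) * (g (x2 - x6) * F)"
    unfolding F_def
    using o s mult_right_mono[OF mono[of "x2 - x6" "x1 - x5"], of "g (x3 - x5) * g (x4 - x5)"]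
    by (intro mult_left_mono) (auto simp: nn algebra_simps)
  also have "\<dots> \<le> g (x1 - x6) * (g (x2 - x6) * E)"
    using o F0 FE by (intro mult_mono mult_nonneg_nonneg nn mono) auto
  also have "\<dots> \<le> g (x1 - x6) * (g (x1 - x3) * g (x1 - x4) * g (x1 - x5) - g (x2 - x6) * g (x3 - x6) * g (x4 - x6))"
    unfolding E_def
    using o s mult_right_mono[OF mono[of "x2 - x6" "x1 - x5"], of "g (x1 - x3) * g (x1 - x4)"]
    by (intro mult_left_mono) (auto simp: nn algebra_simps)
  finally have R: "R2 \<le> R1"
    by (simp add: R1_def R2_def algebra_simps)
  have R0: "0 \<le> R1"
    unfolding R1_def diff_ge_0_iff_ge
    using o by (intro mult_mono mult_nonneg_nonneg nn mono) auto

  \<comment> \<open>The factors at \<open>x7\<close> are restored: on the left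
    \<open>g (x5 - x7)\<close> is lowered to \<open>g (x6 - x7)\<close>, and at the end of the chain
    \<open>g (x2 - x7)\<close> is raised to \<open>g (x1 - x7)\<close> on the positive term.\<close>
  have "g (x5 - x6) * (g (x6 - x7) * (g (x1 - x6) * g (x2 - x6) * g (x3 - x6) * g (x4 - x6))
        - g (x5 - x7) * (g (x1 - x5) * g (x2 - x5) * g (x3 - x5) * g (x4 - x5)))
      \<le> g (x5 - x6) * (g (x6 - x7) * R2)"
    unfolding R2_def right_diff_distrib
    using o by (intro mult_left_mono diff_left_mono mult_right_mono mult_nonneg_nonneg nn mono) auto
  also have "\<dots> \<le> g (x5 - x6) * (g (x6 - x7) * R1)"
    using o R by (intro mult_left_mono nn) auto
  also have "\<dots> \<le> g (x1 - x2) * (g (x2 - x7) * R1)"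
    using o s R0 by (intro mult_mono mult_nonneg_nonneg nn mono) auto
  also have "\<dots> \<le> g (x1 - x2) * (g (x1 - x7) * (g (x1 - x3) * g (x1 - x4) * g (x1 - x5) * g (x1 - x6))
        - g (x2 - x7) * (g (x2 - x3) * g (x2 - x4) * g (x2 - x5) * g (x2 - x6)))"
    unfolding R1_def right_diff_distrib
    using o by (intro diff_right_mono mult_left_mono mult_right_mono mult_nonneg_nonneg nn mono) auto
  finally show ?thesis
    by (simp add: algebra_simps)
qed

theorem corollary3:
  fixes x a :: "nat \<Rightarrow> real" and g :: "real \<Rightarrow> real"
  assumes "x 1 \<ge> x 2" and "x 2 \<ge> x 3" and "x 3 \<ge> x 4" and "x 4 \<ge> x 5"
    and "x 5 \<ge> x 6" and "x 6 \<ge> x 7"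
    and "x 1 + x 6 \<ge> x 2 + x 5" and "x 2 + x 5 \<ge> x 3 + x 4"
    and "a 1 \<ge> \<bar>a 2\<bar>" and "\<bar>a 2\<bar> \<ge> a 5" and "a 5 \<ge> \<bar>a 6\<bar> - a 7"
    and "a 3 \<ge> \<bar>a 4\<bar>" and "a 5 \<ge> 0" and "a 7 \<ge> 0"
    and "g \<in> class_G2"
  shows "(\<Sum>i\<in>{1..7}. a i * (\<Prod>j\<in>{1..7} - {i}. g (x i - x j))) \<ge> 0"
proof -
  note o = assms(1-8) and g = \<open>g \<in> class_G2\<close>
  note nn = class_G2_nonneg[OF g] and mono = class_G2_mono[OF g]
  define d where "d i j = g (x i - x j)" for i j
  obtain s where s: "s = 1 \<or> s = - 1" and parity: "\<And>t. g (- t) = s * g t"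
    using class_G2_parity[OF g] by blast
  have flip_up: "d j i = s * d i j" if "i < j" for i j
    using parity[of "x i - x j"] by (simp add: d_def)

  define Q1 where "Q1 = d 1 2 * d 1 3 * d 1 4 * d 1 5 * d 1 6 * d 1 7"
  define Q2 where "Q2 = d 1 2 * d 2 3 * d 2 4 * d 2 5 * d 2 6 * d 2 7"
  define Q3 where "Q3 = d 1 3 * d 2 3 * d 3 4 * d 3 5 * d 3 6 * d 3 7"
  define Q4 where "Q4 = d 1 4 * d 2 4 * d 3 4 * d 4 5 * d 4 6 * d 4 7"
  define Q5 where "Q5 = d 1 5 * d 2 5 * d 3 5 * d 4 5 * d 5 6 * d 5 7"
  define Q6 where "Q6 = d 1 6 * d 2 6 * d 3 6 * d 4 6 * d 5 6 * d 6 7"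
  define Q7 where "Q7 = d 1 7 * d 2 7 * d 3 7 * d 4 7 * d 5 7 * d 6 7"

  have Q0: "0 \<le> Q1" "0 \<le> Q2" "0 \<le> Q3" "0 \<le> Q4" "0 \<le> Q6"
    unfolding Q1_def Q2_def Q3_def Q4_def Q6_def d_def
    using o by (auto intro!: mult_nonneg_nonneg nn)
  have Q21: "Q2 \<le> Q1"
    unfolding Q1_def Q2_def d_def
    using o by (intro mult_mono mult_nonneg_nonneg nn mono) auto
  have Q67: "Q6 \<le> Q7"
    unfolding Q6_def Q7_def d_def
    using o by (intro mult_mono mult_nonneg_nonneg nn mono) auto
  have Q43: "Q4 \<le> Q3"
    unfolding Q3_def Q4_def d_def
    using o by (intro products_third_ge_fourth[OF g]) auto
  have Q6521: "Q6 - Q5 \<le> Q1 - Q2"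
    unfolding Q1_def Q2_def Q5_def Q6_def d_def
    using o by (intro products_six_le_one_two_five[OF g]) auto

  have idx: "{1..7::nat} = {1, 2, 3, 4, 5, 6, 7}"
    by auto
  \<comment> \<open>Reorienting the \<open>i - 1\<close> factors with \<open>j < i\<close> gives the
    sign \<open>s ^ (i - 1)\<close>, which survives only for even \<open>i\<close>.\<close>
  have "(\<Sum>i\<in>{1..7}. a i * (\<Prod>j\<in>{1..7} - {i}. d i j)) =
    a 1 * Q1 + s * a 2 * Q2 + a 3 * Q3 + s * a 4 * Q4 + a 5 * Q5 + s * a 6 * Q6 + a 7 * Q7"
    using s unfolding idx Q1_def Q2_def Q3_def Q4_def Q5_def Q6_def Q7_def
    by (elim disjE) (simp_all add: insert_Diff_if flip_up algebra_simps)
  moreover have "0 \<le> \<dots>"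
  proof -
    have lower: "- (\<bar>c\<bar> * q) \<le> s * c * q" if "0 \<le> q" for c q
      using s mult_right_mono[OF abs_ge_self[of c] that] mult_right_mono[OF abs_ge_minus_self[of c] that]
      by auto
    \<comment> \<open>The weight of \<open>Q1 - Q2\<close> is split as
      \<open>(\<bar>a 2\<bar> - a 5) + a 5\<close>; the second share pays for
      \<open>a 5 * (Q6 - Q5)\<close>, and \<open>a 7 * Q7\<close> covers the rest of
      \<open>\<bar>a 6\<bar> * Q6\<close>.\<close>
    have "\<bar>a 2\<bar> * Q1 \<le> a 1 * Q1" "\<bar>a 4\<bar> * Q4 \<le> a 3 * Q4" "a 3 * Q4 \<le> a 3 * Q3"
      "\<bar>a 6\<bar> * Q6 \<le> (a 5 + a 7) * Q6" "a 7 * Q6 \<le> a 7 * Q7"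
      using assms Q0 Q43 Q67 by (auto intro!: mult_right_mono mult_left_mono)
    moreover have "a 5 * (Q1 - Q2) \<le> \<bar>a 2\<bar> * (Q1 - Q2)"
      using assms Q21 by (intro mult_right_mono) auto
    moreover have "a 5 * (Q6 - Q5) \<le> a 5 * (Q1 - Q2)"
      using assms Q6521 by (intro mult_left_mono) auto
    ultimately show ?thesis
      using lower[OF Q0(2), of "a 2"] lower[OF Q0(4), of "a 4"] lower[OF Q0(5), of "a 6"]
      by (simp add: algebra_simps)
  qed
  ultimately show ?thesis
    by (simp add: d_def)
qed

end
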